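(* The gradient $G^R$ of $f_R$ on $\mathcal R_r$ at the point $(W,\Re(V),\Im(V))$, with $W=(w_i)_{1\le i\le r}\in\mathbb R^r$ and $V=[v_i]_{1\le i\le r}\in\mathbb C^{n\times r}$, is the vector $$G^R=\begin{pmatrix}G_1\\ \Re(G_2)\\ -\Im(G_2)\end{pmatrix}\in\mathbb R^{r+2nr},$$ where - $G_1=\Big(\sum_{i=1}^rw_i\Re\big((v_j^*v_i)^d\big)-\Re(\bar{\mathbf p}(v_j))\Big)_{1\le j\le r}\in\mathbb R^r$, - $G_2=\Big(d\sum_{i=1}^rw_iw_j(v_i^*v_j)^{d-1}\bar v_i-w_j\nabla_{\mathbf x}\bar{\mathbf p}(v_j)\Big)_{1\le j\le r}\in\mathbb C^{nr}$.
   Context: $\mathbb C[\mathbf x]_d$ is the space of homogeneous polynomials of degree $d$ in $\mathbf x=(x_1,\dots,x_n)$. Writing $\mathbf p=\sum_{|\alpha|=d}\binom d\alpha p_\alpha\mathbf x^\alpha$, $\mathbf q=\sum_{|\alpha|=d}\binom d\alpha q_\alpha\mathbf x^\alpha$, the apolar product is $\langle\mathbf p,\mathbf q\rangle_d=\sum_{|\alpha|=d}\binom d\alpha\bar p_\alpha q_\alpha$ and $\|\mathbf p\|_d=\sqrt{\langle\mathbf p,\mathbf p\rangle_d}$; $\bar{\mathbf p}=\sum_{|\alpha|=d}\binom d\alpha\bar p_\alpha\mathbf x^\alpha$ is the polynomial with conjugated coefficients. ${}^t$ is transpose, ${}^*$ conjugate transpose, and $\nabla_{\mathbf x}$ the vector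 of partial derivatives $\partial_{x_1},\dots,\partial_{x_n}$. Standing assumptions: $d>2$ and $r<r_g$, where $r_g=\lceil\frac1n\binom{n+d-1}{d}\rceil$ is the generic symmetric rank, increased by $1$ for $(d,n)\in\{(3,5),(4,3),(4,4),(4,5)\}$. A polynomial $\mathbf p\in\mathbb C[\mathbf x]_d$ is fixed. $\mathcal R_r=\{(W,\Re(V),\Im(V)): W\in\mathbb R^r,\ V\in\mathbb C^{n\times r}\}\simeq\mathbb R^{r+2nr}$, with coordinates ordered as $(W,\Re v_1,\dots,\Re v_r,\Im v_1,\dots,\Im v_r)$, and $f_R:\mathcal R_r\to\mathbb R$, $f_R(W,\Re V,\Im V)=\frac12\|\sum_{i=1}^rw_i(v_i^t\mathbf x)^d-\mathbf p\|_d^2$. The gradient is the ordinary vector of real first-order partial derivatives. *)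

theory Defs
  imports "HOL-Analysis.Analysis" "HOL-Library.Poly_Mapping"
begin

text \<open>
  Polynomials over the complex numbers in the variables \<open>x\<^sub>k\<close>, \<open>k :: 'n\<close>, are the elements of
  the monoid ring of \<open>'n \<Rightarrow>\<^sub>0 nat\<close> (multi-indices), so that sums, products and powers are
  the library's.
\<close>

type_synonym 'n mindex = "'n \<Rightarrow>\<^sub>0 nat"
type_synonym 'n cpoly = "'n mindex \<Rightarrow>\<^sub>0 complex"

definition mdeg :: "'n::finite mindex \<Rightarrow> nat" where
  "mdeg \<alpha> = (\<Sum>k\<in>UNIV. Poly_Mapping.lookup \<alpha> k)"

definition homogeneous :: "nat \<Rightarrow> 'n::finite cpoly set" where
  "homogeneous d = {p. \<forall>\<alpha>\<in>Poly_Mapping.keys p. mdeg \<alpha> = d}"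

definition const :: "complex \<Rightarrow> 'n cpoly" where
  "const c = Poly_Mapping.single 0 c"

definition var :: "'n \<Rightarrow> 'n cpoly" where
  "var k = Poly_Mapping.single (Poly_Mapping.single k 1) 1"

definition linear_form :: "complex ^ 'n \<Rightarrow> 'n::finite cpoly" where
  "linear_form v = (\<Sum>k\<in>UNIV. const (v $ k) * var k)"

definition eval_poly :: "'n::finite cpoly \<Rightarrow> complex ^ 'n \<Rightarrow> complex" where
  "eval_poly p v = (\<Sum>\<alpha>\<in>Poly_Mapping.keys p.
     Poly_Mapping.lookup p \<alpha> * (\<Prod>k\<in>UNIV. (v $ k) ^ Poly_Mapping.lookup \<alpha> k))"

text \<open>
  In \<open>pderiv_poly\<close> the truncated subtraction of multi-indices is harmless: if \<open>x\<^sub>k\<close> does not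
  occur in the monomial, the coefficient is \<open>0\<close>.
\<close>

definition pderiv_poly :: "'n \<Rightarrow> 'n::finite cpoly \<Rightarrow> 'n cpoly" where
  "pderiv_poly k p = (\<Sum>\<alpha>\<in>Poly_Mapping.keys p.
     Poly_Mapping.single (\<alpha> - Poly_Mapping.single k 1)
       (of_nat (Poly_Mapping.lookup \<alpha> k) * Poly_Mapping.lookup p \<alpha>))"

definition grad_poly :: "'n::finite cpoly \<Rightarrow> complex ^ 'n \<Rightarrow> complex ^ 'n" where
  "grad_poly p v = (\<chi> k. eval_poly (pderiv_poly k p) v)"

definition conj_poly :: "'n cpoly \<Rightarrow> 'n cpoly" where
  "conj_poly p = Poly_Mapping.map cnj p"

definition multinomial :: "nat \<Rightarrow> 'n::finite mindex \<Rightarrow> real" where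
  "multinomial d \<alpha> = fact d / (\<Prod>k\<in>UNIV. fact (Poly_Mapping.lookup \<alpha> k))"

text \<open>
  The scaled coefficient \<open>p\<^sub>\<alpha>\<close> in \<open>p = (\<Sum>|\<alpha>|=d. multinomial d \<alpha> * p\<^sub>\<alpha> * x\<^sup>\<alpha>)\<close>.
\<close>

definition scaled_coeff :: "nat \<Rightarrow> 'n::finite cpoly \<Rightarrow> 'n mindex \<Rightarrow> complex" where
  "scaled_coeff d p \<alpha> = Poly_Mapping.lookup p \<alpha> / of_real (multinomial d \<alpha>)"

definition apolar :: "nat \<Rightarrow> 'n::finite cpoly \<Rightarrow> 'n cpoly \<Rightarrow> complex" where
  "apolar d p q = (\<Sum>\<alpha> | mdeg \<alpha> = d.
     of_real (multinomial d \<alpha>) * cnj (scaled_coeff d p \<alpha>) * scaled_coeff d q \<alpha>)"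

lemma finite_mdeg: "finite {\<alpha> :: 'n::finite mindex. mdeg \<alpha> = d}"
proof -
  have "Poly_Mapping.lookup \<alpha> k \<le> d" if "mdeg \<alpha> = d" for \<alpha> :: "'n mindex" and k
    using that member_le_sum[of k UNIV "Poly_Mapping.lookup \<alpha>"] by (simp add: mdeg_def)
  then have "Poly_Mapping.lookup ` {\<alpha> :: 'n mindex. mdeg \<alpha> = d} \<subseteq> (UNIV \<rightarrow>\<^sub>E {..d})"
    by auto
  moreover have "finite ((UNIV :: 'n set) \<rightarrow>\<^sub>E {..d})"
    by (intro finite_PiE) auto
  ultimately have "finite (Poly_Mapping.lookup ` {\<alpha> :: 'n mindex. mdeg \<alpha> = d})"
    by (rule finite_subset)
  then show ?thesis
    by (rule finite_imageD) (auto simp: inj_on_def lookup_inject)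
qed

text \<open>\<open>apolar d p p\<close> is a nonnegative real, so taking its real part loses nothing.\<close>

definition apolar_norm :: "nat \<Rightarrow> 'n::finite cpoly \<Rightarrow> real" where
  "apolar_norm d p = sqrt (Re (apolar d p p))"

lemma apolar_self:
  "apolar d p p = of_real (\<Sum>\<alpha> | mdeg \<alpha> = d. multinomial d \<alpha> * (cmod (scaled_coeff d p \<alpha>))\<^sup>2)"
  unfolding apolar_def of_real_sum
  by (intro sum.cong refl) (simp add: complex_norm_square mult_ac flip: of_real_power)

lemma apolar_self_nonneg: "0 \<le> Re (apolar d p p)"
  unfolding apolar_self Re_complex_of_real
  by (intro sum_nonneg mult_nonneg_nonneg) (simp_all add: multinomial_def prod_nonneg)

text \<open>The generic symmetric rank (Alexander--Hirschowitz), for \<open>d > 2\<close>.\<close>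

definition generic_rank :: "nat \<Rightarrow> nat \<Rightarrow> nat" where
  "generic_rank d n = nat \<lceil>real ((n + d - 1) choose d) / real n\<rceil>
     + (if (d, n) \<in> {(3, 5), (4, 3), (4, 4), (4, 5)} then 1 else 0)"

text \<open>
  A point of \<open>\<R>\<^sub>r \<simeq> \<real>\<^sup>r\<^sup>+\<^sup>2\<^sup>n\<^sup>r\<close>: the weights, then the real parts and then the imaginary parts of
  \<open>v\<^sub>1, \<dots>, v\<^sub>r\<close>, each block being an \<open>'r\<close>-indexed family of vectors of length \<open>n\<close>. The
  inner product of this type is the Euclidean one on \<open>\<real>\<^sup>r\<^sup>+\<^sup>2\<^sup>n\<^sup>r\<close>.
\<close>

type_synonym ('n, 'r) rpoint = "(real ^ 'r) \<times> (real ^ 'n ^ 'r) \<times> (real ^ 'n ^ 'r)"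

definition real_coords :: "real ^ 'r \<Rightarrow> complex ^ 'r ^ 'n \<Rightarrow> ('n::finite, 'r::finite) rpoint" where
  "real_coords W V =
     (W, (\<chi> i k. Re (column i V $ k)), (\<chi> i k. Im (column i V $ k)))"

definition f_R :: "nat \<Rightarrow> 'n cpoly \<Rightarrow> ('n::finite, 'r::finite) rpoint \<Rightarrow> real" where
  "f_R d p = (\<lambda>(W, A, B).
     1/2 * (apolar_norm d
       ((\<Sum>i\<in>UNIV. const (of_real (W $ i))
            * linear_form (\<chi> k. Complex (A $ i $ k) (B $ i $ k)) ^ d) - p))\<^sup>2)"

text \<open>\<open>herm v w\<close> is \<open>v\<^sup>* w\<close>.\<close>

definition herm :: "complex ^ 'n \<Rightarrow> complex ^ 'n \<Rightarrow> complex" where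
  "herm v w = (\<Sum>k\<in>UNIV. cnj (v $ k) * w $ k)"

definition conj_vec :: "complex ^ 'n \<Rightarrow> complex ^ 'n" where
  "conj_vec v = (\<chi> k. cnj (v $ k))"

definition G1 ::
  "nat \<Rightarrow> 'n::finite cpoly \<Rightarrow> real ^ 'r \<Rightarrow> complex ^ 'r ^ 'n \<Rightarrow> real ^ 'r::finite" where
  "G1 d p W V = (\<chi> j.
     (\<Sum>i\<in>UNIV. W $ i * Re (herm (column j V) (column i V) ^ d))
     - Re (eval_poly (conj_poly p) (column j V)))"

definition G2 ::
  "nat \<Rightarrow> 'n::finite cpoly \<Rightarrow> real ^ 'r \<Rightarrow> complex ^ 'r ^ 'n \<Rightarrow> complex ^ 'n ^ 'r::finite" where
  "G2 d p W V = (\<chi> j.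
     of_nat d *s (\<Sum>i\<in>UNIV.
       (of_real (W $ i) * of_real (W $ j) * herm (column i V) (column j V) ^ (d - 1))
         *s conj_vec (column i V))
     - of_real (W $ j) *s grad_poly (conj_poly p) (column j V))"

text \<open>
  The library's \<open>GDERIV\<close> is defined by the Frechet derivative; the components of that gradient are
  the ordinary first-order partial derivatives.
\<close>

lemma GDERIV_partial_derivative:
  fixes f :: "'a::euclidean_space \<Rightarrow> real"
  assumes "GDERIV f z :> G" and "b \<in> Basis"
  shows "((\<lambda>t. f (z + t *\<^sub>R b)) has_real_derivative (G \<bullet> b)) (at 0)"
proof -
  have "(f has_derivative (\<lambda>h. h \<bullet> G)) (at (z + 0 *\<^sub>R b))"
    using assms(1) by (simp add: gderiv_def)
  moreover have "((\<lambda>t. z + t *\<^sub>R b) has_derivative (\<lambda>t. t *\<^sub>R b)) (at 0)"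
    by (auto intro!: derivative_eq_intros)
  ultimately have "((\<lambda>t. f (z + t *\<^sub>R b)) has_derivative (\<lambda>t. (t *\<^sub>R b) \<bullet> G)) (at 0)"
    by (rule has_derivative_compose[rotated])
  then show ?thesis
    by (simp add: has_field_derivative_def mult.commute inner_commute
        mult_commute_abs)
qed

end

theory Submission
  imports Defs
begin

text \<open>
  Two properties of the apolar product turn the objective into an explicit function of the weights
  and vectors. First, powers of linear forms reproduce evaluation: \<open>\<langle>q, (v\<^sup>t x)\<^sup>d\<rangle>\<^sub>d\<close> is the value of the
  conjugated polynomial of \<open>q\<close> at \<open>v\<close> (\<open>apolar_linear_form_power\<close>). The reason is that by the
  multinomial theorem the scaled coefficients of \<open>(v\<^sup>t x)\<^sup>d\<close> are the monomials \<open>v\<^sup>\<alpha>\<close>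
  (\<open>lookup_linear_form_power\<close>). Second, taking \<open>q = (u\<^sup>t x)\<^sup>d\<close>, one gets
  \<open>\<langle>(u\<^sup>t x)\<^sup>d, (v\<^sup>t x)\<^sup>d\<rangle>\<^sub>d = (u\<^sup>* v)\<^sup>d\<close> (\<open>apolar_linear_form_powers\<close>). Sesquilinearity then gives, up to
  the additive constant \<open>1/2 \<parallel>p\<parallel>\<^sup>2\<close>,

  \<open>f = 1/2 \<Sum>\<^sub>i\<Sum>\<^sub>j w\<^sub>i w\<^sub>j Re ((v\<^sub>i\<^sup>* v\<^sub>j)\<^sup>d) - \<Sum>\<^sub>i w\<^sub>i Re (q(v\<^sub>i))\<close>, where \<open>q\<close> is the conjugate of \<open>p\<close>.

  This expression is differentiated termwise over the reals (\<open>has_derivative_f_R\<close>). Moving \<open>v\<^sub>j\<close> in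
  the direction \<open>c\<close> changes \<open>v\<^sub>i\<^sup>* v\<^sub>j\<close> by \<open>v\<^sub>i\<^sup>* c\<close> and \<open>v\<^sub>j\<^sup>* v\<^sub>i\<close> by its conjugate \<open>c\<^sup>* v\<^sub>i\<close>. These two
  contributions have equal real parts, which absorbs the factor \<open>1/2\<close>. What remains in the vector
  directions has the form \<open>Re (\<Sum>\<^sub>j G\<^sub>2\<^sub>j\<^sup>t c\<^sub>j) = \<Sum>\<^sub>j (Re G\<^sub>2\<^sub>j \<bullet> Re c\<^sub>j - Im G\<^sub>2\<^sub>j \<bullet> Im c\<^sub>j)\<close>, without a
  conjugation; this is where the sign of the last block of the gradient comes from.
\<close>

section \<open>Evaluation as a ring homomorphism\<close>

definition monom_eval :: "'n::finite mindex \<Rightarrow> complex ^ 'n \<Rightarrow> complex" where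
  "monom_eval \<alpha> v = (\<Prod>k\<in>UNIV. (v $ k) ^ Poly_Mapping.lookup \<alpha> k)"

lemma monom_eval_0 [simp]: "monom_eval 0 v = 1"
  by (simp add: monom_eval_def)

lemma monom_eval_add: "monom_eval (\<alpha> + \<beta>) v = monom_eval \<alpha> v * monom_eval \<beta> v"
  by (simp add: monom_eval_def lookup_add power_add prod.distrib)

lemma monom_eval_single: "monom_eval (Poly_Mapping.single k n) v = (v $ k) ^ n"
proof -
  have "monom_eval (Poly_Mapping.single k n) v = (\<Prod>j\<in>UNIV. if k = j then (v $ j) ^ n else 1)"
    unfolding monom_eval_def by (rule prod.cong) (auto simp: lookup_single)
  then show ?thesis
    by simp
qed

lemma monom_eval_conj_vec: "monom_eval \<alpha> (conj_vec v) = cnj (monom_eval \<alpha> v)"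
  by (simp add: monom_eval_def conj_vec_def)

text \<open>
  Summing over any finite set containing the support removes the dependence of the index set on
  the polynomial, which is what makes evaluation visibly additive.
\<close>

lemma eval_poly_superset:
  assumes "finite S" "Poly_Mapping.keys p \<subseteq> S"
  shows "eval_poly p v = (\<Sum>\<alpha>\<in>S. Poly_Mapping.lookup p \<alpha> * monom_eval \<alpha> v)"
  unfolding eval_poly_def monom_eval_def
  by (rule sum.mono_neutral_left) (use assms in \<open>auto simp: in_keys_iff\<close>)

lemma eval_poly_0 [simp]: "eval_poly 0 v = 0"
  by (simp add: eval_poly_def)

lemma eval_poly_single: "eval_poly (Poly_Mapping.single \<alpha> c) v = c * monom_eval \<alpha> v"
  by (subst eval_poly_superset[of "{\<alpha>}"]) auto

lemma eval_poly_add: "eval_poly (p + q) v = eval_poly p v + eval_poly q v"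
proof -
  let ?S = "Poly_Mapping.keys p \<union> Poly_Mapping.keys q"
  have "eval_poly r v = (\<Sum>\<alpha>\<in>?S. Poly_Mapping.lookup r \<alpha> * monom_eval \<alpha> v)"
    if "Poly_Mapping.keys r \<subseteq> ?S" for r
    by (rule eval_poly_superset) (use that in auto)
  then show ?thesis
    using Poly_Mapping.keys_add[of p q]
    by (simp add: lookup_add distrib_right sum.distrib)
qed

lemma eval_poly_sum: "eval_poly (\<Sum>i\<in>I. f i) v = (\<Sum>i\<in>I. eval_poly (f i) v)"
  by (induction I rule: infinite_finite_induct) (simp_all add: eval_poly_add)

lemma sum_monomials:
  fixes p :: "'a \<Rightarrow>\<^sub>0 'b::comm_monoid_add"
  shows "p = (\<Sum>\<alpha>\<in>Poly_Mapping.keys p. Poly_Mapping.single \<alpha> (Poly_Mapping.lookup p \<alpha>))"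
  by (rule poly_mapping_eqI)
    (auto simp: lookup_sum lookup_single when_def in_keys_iff sum.delta')

lemma eval_poly_mult: "eval_poly (p * q) v = eval_poly p v * eval_poly q v"
proof -
  have "p * q = (\<Sum>\<alpha>\<in>Poly_Mapping.keys p. \<Sum>\<beta>\<in>Poly_Mapping.keys q.
      Poly_Mapping.single (\<alpha> + \<beta>) (Poly_Mapping.lookup p \<alpha> * Poly_Mapping.lookup q \<beta>))"
    by (subst sum_monomials[of p], subst sum_monomials[of q])
      (simp add: sum_product mult_single)
  then have "eval_poly (p * q) v = (\<Sum>\<alpha>\<in>Poly_Mapping.keys p. \<Sum>\<beta>\<in>Poly_Mapping.keys q.
      (Poly_Mapping.lookup p \<alpha> * monom_eval \<alpha> v) * (Poly_Mapping.lookup q \<beta> * monom_eval \<beta> v))"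
    by (simp add: eval_poly_sum eval_poly_single monom_eval_add mult_ac)
  also have "\<dots> = eval_poly p v * eval_poly q v"
    by (simp add: eval_poly_def monom_eval_def sum_product)
  finally show ?thesis .
qed

lemma eval_poly_power: "eval_poly (p ^ m) v = eval_poly p v ^ m"
proof (induction m)
  case 0
  show ?case
    using eval_poly_single[of 0 1 v] by simp
qed (simp add: eval_poly_mult)

lemma const_mult_var: "const c * var k = Poly_Mapping.single (Poly_Mapping.single k 1) c"
  by (simp add: const_def var_def mult_single)

lemma eval_poly_linear_form: "eval_poly (linear_form u) v = (\<Sum>k\<in>UNIV. u $ k * v $ k)"
  unfolding linear_form_def const_mult_var eval_poly_sum eval_poly_single monom_eval_single
  by simp

section \<open>Coefficients of powers of linear forms\<close>

lemma mult_single_expand: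
  fixes q :: "'n::finite cpoly"
  shows "q * Poly_Mapping.single \<beta> c =
    (\<Sum>\<gamma>\<in>Poly_Mapping.keys q. Poly_Mapping.single (\<gamma> + \<beta>) (Poly_Mapping.lookup q \<gamma> * c))"
  by (subst sum_monomials[of q]) (simp add: sum_distrib_right mult_single)

lemma lookup_mult_single:
  fixes q :: "'n::finite cpoly"
  shows "Poly_Mapping.lookup (q * Poly_Mapping.single \<beta> c) (\<alpha> + \<beta>) = Poly_Mapping.lookup q \<alpha> * c"
  unfolding mult_single_expand
  by (auto simp: lookup_sum lookup_single when_def in_keys_iff sum.delta')

lemma lookup_mult_single_eq_0:
  fixes q :: "'n::finite cpoly"
  assumes "\<And>\<gamma>. \<alpha> \<noteq> \<gamma> + \<beta>"
  shows "Poly_Mapping.lookup (q * Poly_Mapping.single \<beta> c) \<alpha> = 0"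
  unfolding mult_single_expand
  using assms[symmetric] by (simp add: lookup_sum lookup_single)

lemma lookup_const_mult:
  fixes q :: "'n::finite cpoly"
  shows "Poly_Mapping.lookup (const c * q) \<alpha> = c * Poly_Mapping.lookup q \<alpha>"
  using lookup_mult_single[of q 0 c \<alpha>] by (simp add: const_def mult.commute)

lemma mindex_split_single:
  fixes \<alpha> :: "'n mindex"
  assumes "Poly_Mapping.lookup \<alpha> k \<noteq> 0"
  shows "\<alpha> = (\<alpha> - Poly_Mapping.single k 1) + Poly_Mapping.single k 1"
  by (rule poly_mapping_eqI)
    (use assms in \<open>auto simp: lookup_add lookup_minus lookup_single when_def\<close>)

lemma mdeg_add: "mdeg (\<alpha> + \<beta>) = mdeg \<alpha> + mdeg \<beta>"
  by (simp add: mdeg_def lookup_add sum.distrib)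

lemma mdeg_single: "mdeg (Poly_Mapping.single k n) = n"
  by (simp add: mdeg_def lookup_single when_def)

lemma mdeg_eq_0_iff: "mdeg \<alpha> = 0 \<longleftrightarrow> \<alpha> = 0"
  by (auto simp: mdeg_def intro: poly_mapping_eqI)

lemma multinomial_nonzero: "multinomial d \<alpha> \<noteq> 0"
  by (simp add: multinomial_def)

lemma prod_fact_add_single:
  fixes \<beta> :: "'n::finite mindex"
  shows "(\<Prod>j\<in>UNIV. fact (Poly_Mapping.lookup (\<beta> + Poly_Mapping.single k 1) j) :: real)
    = (Poly_Mapping.lookup \<beta> k + 1) * (\<Prod>j\<in>UNIV. fact (Poly_Mapping.lookup \<beta> j))"
proof -
  have "(\<Prod>j\<in>UNIV - {k}. fact (Poly_Mapping.lookup (\<beta> + Poly_Mapping.single k 1) j) :: real)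
      = (\<Prod>j\<in>UNIV - {k}. fact (Poly_Mapping.lookup \<beta> j))"
    by (rule prod.cong) (auto simp: lookup_add lookup_single)
  then show ?thesis
    by (simp only: prod.remove[of UNIV k] finite UNIV_I) (simp add: lookup_add algebra_simps)
qed

text \<open>
  The step of Pascal's rule for multinomial coefficients: summed over \<open>k\<close> with
  \<open>\<alpha> = \<beta> + e\<^sub>k\<close>, the left-hand factors \<open>\<alpha>\<^sub>k\<close> add up to \<open>|\<alpha>|\<close>.
\<close>

lemma multinomial_add_single:
  "real (Poly_Mapping.lookup \<beta> k + 1) * multinomial (Suc d) (\<beta> + Poly_Mapping.single k 1)
    = real (Suc d) * multinomial d \<beta>"
proof -
  have "x * (real (Suc d) * f / (x * P)) = real (Suc d) * (f / P)" if "x \<noteq> 0" for x f P :: real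
    using that by simp
  from this[of "real (Poly_Mapping.lookup \<beta> k + 1)"] show ?thesis
    unfolding multinomial_def prod_fact_add_single fact_Suc of_nat_mult by simp
qed

text \<open>
  The multinomial theorem, as a formula for coefficients. The induction on \<open>d\<close> splits off one linear
  factor: the coefficient of \<open>x\<^sup>\<alpha>\<close> in \<open>(v\<^sup>t x)\<^sup>d\<^sup>+\<^sup>1\<close> is the sum over \<open>k\<close> of \<open>v\<^sub>k\<close> times the coefficient of
  \<open>x\<^sup>\<alpha>\<close> divided by \<open>x\<^sub>k\<close>. The summand for \<open>k\<close> is the fraction \<open>\<alpha>\<^sub>k / (d + 1)\<close> of the claimed value, and
  these fractions add up to \<open>1\<close> when \<open>|\<alpha>| = d + 1\<close>.
\<close>

lemma lookup_linear_form_power: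
  "Poly_Mapping.lookup (linear_form v ^ d) \<alpha>
    = (if mdeg \<alpha> = d then of_real (multinomial d \<alpha>) * monom_eval \<alpha> v else 0)"
proof (induction d arbitrary: \<alpha>)
  case 0
  show ?case
    by (auto simp: mdeg_eq_0_iff lookup_one multinomial_def)
next
  case (Suc d)
  let ?t = "\<lambda>k. Poly_Mapping.lookup
    (linear_form v ^ d * Poly_Mapping.single (Poly_Mapping.single k 1) (v $ k)) \<alpha>"
  let ?M = "of_real (multinomial (Suc d) \<alpha>) * monom_eval \<alpha> v"
  have expand: "Poly_Mapping.lookup (linear_form v ^ Suc d) \<alpha> = (\<Sum>k\<in>UNIV. ?t k)"
    by (simp only: power_Suc2 linear_form_def[of v, unfolded const_mult_var]
        sum_distrib_left lookup_sum)
  \<comment> \<open>Multiplying by \<open>d + 1\<close> avoids division and lets the case \<open>\<alpha>\<^sub>k = 0\<close>, where \<open>x\<^sub>k\<close> does not divide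
     the monomial, follow the same formula.\<close>
  have t: "of_nat (Suc d) * ?t k
      = (if mdeg \<alpha> = Suc d then of_nat (Poly_Mapping.lookup \<alpha> k) * ?M else 0)" for k
  proof (cases "Poly_Mapping.lookup \<alpha> k = 0")
    case True
    have "\<alpha> \<noteq> \<gamma> + Poly_Mapping.single k 1" for \<gamma>
      using True by (auto simp: lookup_add)
    then show ?thesis
      using True lookup_mult_single_eq_0[of \<alpha> "Poly_Mapping.single k 1"] by simp
  next
    case False
    define \<beta> where "\<beta> = \<alpha> - Poly_Mapping.single k 1"
    have \<alpha>: "\<alpha> = \<beta> + Poly_Mapping.single k 1"
      unfolding \<beta>_def by (rule mindex_split_single[OF False])
    have "?t k = Poly_Mapping.lookup (linear_form v ^ d) \<beta> * v $ k"
      unfolding \<alpha> by (rule lookup_mult_single)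
    moreover have "mdeg \<alpha> = Suc (mdeg \<beta>)"
      by (simp add: \<alpha> mdeg_add mdeg_single)
    moreover have "of_nat (Poly_Mapping.lookup \<alpha> k) * ?M
        = of_nat (Suc d) * of_real (multinomial d \<beta>) * monom_eval \<alpha> v"
      using arg_cong[OF multinomial_add_single[of \<beta> k d], of complex_of_real]
      by (simp add: \<alpha> lookup_add)
    moreover have "monom_eval \<alpha> v = monom_eval \<beta> v * v $ k"
      by (simp only: \<alpha> monom_eval_add monom_eval_single power_one_right)
    ultimately show ?thesis
      by (simp only: Suc.IH) (simp add: mult_ac)
  qed
  have sum_t: "(\<Sum>k\<in>UNIV. of_nat (Poly_Mapping.lookup \<alpha> k) * ?M) = of_nat (mdeg \<alpha>) * ?M"
    by (simp add: mdeg_def sum_distrib_right)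
  have "of_nat (Suc d) * Poly_Mapping.lookup (linear_form v ^ Suc d) \<alpha>
      = (if mdeg \<alpha> = Suc d then of_nat (mdeg \<alpha>) * ?M else 0)"
    unfolding expand sum_distrib_left t
    by (cases "mdeg \<alpha> = Suc d") (simp_all only: if_True if_False simp_thms sum_t sum.neutral_const)
  also have "\<dots> = of_nat (Suc d) * (if mdeg \<alpha> = Suc d then ?M else 0)"
    by simp
  finally show ?case
    by (simp only: mult_left_cancel of_nat_neq_0 not_False_eq_True simp_thms)
qed

section \<open>The apolar product and evaluation\<close>

lemma lookup_conj_poly: "Poly_Mapping.lookup (conj_poly p) \<alpha> = cnj (Poly_Mapping.lookup p \<alpha>)"
  by (simp add: conj_poly_def Poly_Mapping.map.rep_eq when_def)

lemma cnj_apolar: "cnj (apolar d p q) = apolar d q p"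
  by (simp add: apolar_def mult_ac)

lemma apolar_diff_right: "apolar d p (q - r) = apolar d p q - apolar d p r"
  by (simp add: apolar_def scaled_coeff_def lookup_minus diff_divide_distrib algebra_simps
      sum_subtractf)

lemma apolar_diff_left: "apolar d (q - r) p = apolar d q p - apolar d r p"
  using arg_cong[OF apolar_diff_right[of d p q r], of cnj] by (simp add: cnj_apolar)

lemma apolar_lincomb_right:
  "apolar d p (\<Sum>i\<in>I. const (c i) * q i) = (\<Sum>i\<in>I. c i * apolar d p (q i))"
  unfolding apolar_def scaled_coeff_def lookup_sum lookup_const_mult
  by (simp add: sum_distrib_left sum_divide_distrib mult_ac) (rule sum.swap)

lemma apolar_lincomb_left:
  "apolar d (\<Sum>i\<in>I. const (c i) * q i) p = (\<Sum>i\<in>I. cnj (c i) * apolar d (q i) p)"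
  using arg_cong[OF apolar_lincomb_right[of d p c q I], of cnj] by (simp add: cnj_apolar)

text \<open>
  The reproducing property. The weight \<open>multinomial d \<alpha>\<close> of the apolar product cancels against one of
  the two divisions hidden in the scaled coefficients, and the other division against the
  multinomial coefficient of the power; what is left is \<open>\<Sum> cnj q\<^sub>\<alpha> v\<^sup>\<alpha>\<close> with the plain coefficients
  of \<open>q\<close>. Homogeneity ensures that the apolar product sees all of them.
\<close>

lemma apolar_linear_form_power:
  assumes "q \<in> homogeneous d"
  shows "apolar d q (linear_form v ^ d) = eval_poly (conj_poly q) v"
proof -
  have "apolar d q (linear_form v ^ d)
      = (\<Sum>\<alpha> | mdeg \<alpha> = d. cnj (Poly_Mapping.lookup q \<alpha>) * monom_eval \<alpha> v)"
    unfolding apolar_def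
    by (rule sum.cong)
      (simp_all add: scaled_coeff_def lookup_linear_form_power multinomial_nonzero)
  also have "\<dots> = eval_poly (conj_poly q) v"
    using assms
    by (subst eval_poly_superset[OF finite_mdeg[of d]])
      (auto simp: homogeneous_def in_keys_iff lookup_conj_poly)
  finally show ?thesis .
qed

lemma linear_form_power_homogeneous: "linear_form v ^ d \<in> homogeneous d"
  by (auto simp: homogeneous_def in_keys_iff lookup_linear_form_power split: if_splits)

lemma conj_poly_linear_form_power: "conj_poly (linear_form v ^ d) = linear_form (conj_vec v) ^ d"
  by (rule poly_mapping_eqI)
    (simp add: lookup_conj_poly lookup_linear_form_power monom_eval_conj_vec)

lemma apolar_linear_form_powers:
  "apolar d (linear_form u ^ d) (linear_form v ^ d) = herm u v ^ d"
  by (simp add: apolar_linear_form_power[OF linear_form_power_homogeneous]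
      conj_poly_linear_form_power eval_poly_power eval_poly_linear_form herm_def conj_vec_def)

lemma Re_of_real_mult: "Re (of_real a * z) = a * Re z"
  by simp

text \<open>
  The square is expanded by sesquilinearity; the two mixed products are conjugate to each other,
  so that their real parts combine into one sum with the factor \<open>2\<close>.
\<close>

lemma apolar_norm_square_decomposition:
  fixes w :: "'i \<Rightarrow> real" and v :: "'i \<Rightarrow> complex ^ 'n::finite"
  assumes "p \<in> homogeneous d"
  shows "(apolar_norm d ((\<Sum>i\<in>I. const (of_real (w i)) * linear_form (v i) ^ d) - p))\<^sup>2
    = (\<Sum>i\<in>I. \<Sum>j\<in>I. w i * w j * Re (herm (v i) (v j) ^ d))
      - 2 * (\<Sum>i\<in>I. w i * Re (eval_poly (conj_poly p) (v i))) + Re (apolar d p p)"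
proof -
  let ?S = "\<Sum>i\<in>I. const (of_real (w i)) * linear_form (v i) ^ d"
  have "Re (apolar d ?S p) = Re (apolar d p ?S)"
    by (subst cnj_apolar[symmetric]) simp
  moreover have "(apolar_norm d (?S - p))\<^sup>2 = Re (apolar d (?S - p) (?S - p))"
    by (simp add: apolar_norm_def apolar_self_nonneg)
  ultimately have "(apolar_norm d (?S - p))\<^sup>2
      = Re (apolar d ?S ?S) - 2 * Re (apolar d p ?S) + Re (apolar d p p)"
    by (simp add: apolar_diff_left apolar_diff_right)
  also have "Re (apolar d p ?S) = (\<Sum>i\<in>I. w i * Re (eval_poly (conj_poly p) (v i)))"
    by (simp add: apolar_lincomb_right apolar_linear_form_power[OF assms])
  also have "apolar d ?S ?S
      = (\<Sum>i\<in>I. \<Sum>j\<in>I. of_real (w i * w j) * herm (v i) (v j) ^ d)"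
    by (subst sum.swap) (simp add: apolar_lincomb_left apolar_lincomb_right
        apolar_linear_form_powers sum_distrib_left mult_ac)
  also have "Re \<dots> = (\<Sum>i\<in>I. \<Sum>j\<in>I. w i * w j * Re (herm (v i) (v j) ^ d))"
    by (simp only: Re_sum Re_of_real_mult)
  finally show ?thesis .
qed

section \<open>Derivatives\<close>

lemma eval_poly_pderiv_poly:
  "eval_poly (pderiv_poly k p) v = (\<Sum>\<alpha>\<in>Poly_Mapping.keys p. Poly_Mapping.lookup p \<alpha>
     * (of_nat (Poly_Mapping.lookup \<alpha> k) * monom_eval (\<alpha> - Poly_Mapping.single k 1) v))"
  by (simp add: pderiv_poly_def eval_poly_sum eval_poly_single mult_ac)

text \<open>
  If \<open>\<alpha>\<^sub>k = 0\<close>, the truncated differences \<open>\<alpha> - e\<^sub>k\<close> and \<open>\<alpha>\<^sub>k - 1\<close> do not describe a derivative, but they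
  are multiplied by \<open>\<alpha>\<^sub>k\<close>.
\<close>

lemma has_derivative_monom_eval:
  "(monom_eval \<alpha> has_derivative (\<lambda>h. \<Sum>k\<in>UNIV. of_nat (Poly_Mapping.lookup \<alpha> k)
     * monom_eval (\<alpha> - Poly_Mapping.single k 1) v * h $ k)) (at v)"
proof -
  have factor: "(v $ k) ^ (Poly_Mapping.lookup \<alpha> k - 1)
      * (\<Prod>j\<in>UNIV - {k}. (v $ j) ^ Poly_Mapping.lookup \<alpha> j)
      = monom_eval (\<alpha> - Poly_Mapping.single k 1) v" for k
  proof -
    have "(\<Prod>j\<in>UNIV - {k}. (v $ j) ^ Poly_Mapping.lookup \<alpha> j)
        = (\<Prod>j\<in>UNIV - {k}. (v $ j) ^ Poly_Mapping.lookup (\<alpha> - Poly_Mapping.single k 1) j)"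
      by (rule prod.cong) (auto simp: lookup_minus lookup_single)
    then show ?thesis
      by (simp add: monom_eval_def prod.remove[of UNIV k] lookup_minus)
  qed
  have "((\<lambda>u. u $ k) has_derivative (\<lambda>h. h $ k)) (at v)" for k
    by (rule bounded_linear_imp_has_derivative) (rule bounded_linear_vec_nth)
  then have "(monom_eval \<alpha> has_derivative (\<lambda>h. \<Sum>k\<in>UNIV.
      (of_nat (Poly_Mapping.lookup \<alpha> k) * h $ k * (v $ k) ^ (Poly_Mapping.lookup \<alpha> k - 1))
      * (\<Prod>j\<in>UNIV - {k}. (v $ j) ^ Poly_Mapping.lookup \<alpha> j))) (at v)"
    unfolding monom_eval_def
    by (intro has_derivative_prod has_derivative_power)
  then show ?thesis
    by (simp only: mult.assoc factor) (simp only: mult_ac)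
qed

text \<open>
  The real Frechet derivative of a polynomial is complex-linear: it pairs the gradient with the
  direction bilinearly, without conjugation.
\<close>

lemma has_derivative_eval_poly:
  "(eval_poly p has_derivative (\<lambda>h. \<Sum>k\<in>UNIV. grad_poly p v $ k * h $ k)) (at v)"
proof -
  have "(eval_poly p has_derivative (\<lambda>h. \<Sum>\<alpha>\<in>Poly_Mapping.keys p. Poly_Mapping.lookup p \<alpha> *
      (\<Sum>k\<in>UNIV. of_nat (Poly_Mapping.lookup \<alpha> k)
        * monom_eval (\<alpha> - Poly_Mapping.single k 1) v * h $ k))) (at v)"
    unfolding eval_poly_def monom_eval_def[symmetric]
    by (intro has_derivative_sum has_derivative_mult_right has_derivative_monom_eval)
  moreover have "(\<Sum>\<alpha>\<in>Poly_Mapping.keys p. Poly_Mapping.lookup p \<alpha> *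
      (\<Sum>k\<in>UNIV. of_nat (Poly_Mapping.lookup \<alpha> k)
        * monom_eval (\<alpha> - Poly_Mapping.single k 1) v * h $ k))
      = (\<Sum>k\<in>UNIV. grad_poly p v $ k * h $ k)" for h
    unfolding grad_poly_def vec_lambda_beta eval_poly_pderiv_poly
    by (simp only: sum_distrib_left sum_distrib_right mult.assoc) (rule sum.swap)
  ultimately show ?thesis
    by simp
qed

text \<open>
  The Hermitian product is only real-bilinear, so differentiability is over the reals.
\<close>

lemma has_derivative_herm:
  assumes "(f has_derivative f') (at z)" "(g has_derivative g') (at z)"
  shows "((\<lambda>z. herm (f z) (g z)) has_derivative (\<lambda>h. herm (f' h) (g z) + herm (f z) (g' h))) (at z)"
proof -
  have nth: "((\<lambda>z. F z $ k) has_derivative (\<lambda>h. F' h $ k)) (at z)"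
    if "(F has_derivative F') (at z)" for F F' and k
    by (rule bounded_linear.has_derivative[OF bounded_linear_vec_nth that])
  have "((\<lambda>z. herm (f z) (g z)) has_derivative
      (\<lambda>h. \<Sum>k\<in>UNIV. cnj (f z $ k) * g' h $ k + cnj (f' h $ k) * g z $ k)) (at z)"
    unfolding herm_def
    by (intro has_derivative_sum has_derivative_mult has_derivative_cnj nth assms)
  then show ?thesis
    by (simp add: herm_def sum.distrib add.commute)
qed

lemma cnj_herm: "cnj (herm u v) = herm v u"
  by (simp add: herm_def mult.commute)

text \<open>
  The complex vector \<open>v\<^sub>i\<close> encoded by a real point, as a real-linear function of that point. Since it is
  linear, its derivative in the direction \<open>h\<close> is the vector encoded by \<open>h\<close> itself.
\<close>

definition cvec :: "('n::finite, 'r::finite) rpoint \<Rightarrow> 'r \<Rightarrow> complex ^ 'n" where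
  "cvec z i = (\<chi> k. Complex (fst (snd z) $ i $ k) (snd (snd z) $ i $ k))"

lemma bounded_linear_cvec: "bounded_linear (\<lambda>z. cvec z i)"
  unfolding linear_conv_bounded_linear[symmetric]
  by (rule linearI) (simp_all add: cvec_def vec_eq_iff complex_eq_iff)

text \<open>
  The product rule yields every pair \<open>(i, j)\<close> twice, once with the increment in the first and once
  in the second factor. Exchanging the summation indices and conjugating identifies the two halves,
  because \<open>v\<^sub>i\<^sup>* v\<^sub>j\<close> and \<open>v\<^sub>j\<^sup>* v\<^sub>i\<close> are conjugate; this cancels the factor \<open>1/2\<close>.
\<close>

lemma has_derivative_f_R:
  fixes p :: "'n::finite cpoly" and z :: "('n, 'r::finite) rpoint"
  assumes p: "p \<in> homogeneous d"
  defines "v \<equiv> cvec z" and "w \<equiv> (\<lambda>i. fst z $ i)"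
  shows "(f_R d p has_derivative (\<lambda>h.
      (\<Sum>j\<in>UNIV. fst h $ j * ((\<Sum>i\<in>UNIV. w i * Re (herm (v j) (v i) ^ d))
         - Re (eval_poly (conj_poly p) (v j))))
    + (\<Sum>j\<in>UNIV. Re (of_nat d * (\<Sum>i\<in>UNIV. of_real (w i) * of_real (w j)
           * herm (v i) (v j) ^ (d - 1) * herm (v i) (cvec h j))
         - of_real (w j) * (\<Sum>k\<in>UNIV. grad_poly (conj_poly p) (v j) $ k * cvec h j $ k))))) (at z)"
proof -
  have f: "f_R d p = (\<lambda>z.
      1/2 * (\<Sum>i\<in>UNIV. \<Sum>j\<in>UNIV. fst z $ i * fst z $ j * Re (herm (cvec z i) (cvec z j) ^ d))
      - (\<Sum>i\<in>UNIV. fst z $ i * Re (eval_poly (conj_poly p) (cvec z i)))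
      + 1/2 * Re (apolar d p p))"
    by (auto simp: f_R_def apolar_norm_square_decomposition[OF p] cvec_def)
  have dw: "((\<lambda>z. fst z $ i) has_derivative (\<lambda>h. fst h $ i)) (at z)" for i
    by (rule bounded_linear.has_derivative[OF bounded_linear_vec_nth])
      (auto intro!: derivative_eq_intros)
  have dv: "((\<lambda>z. cvec z i) has_derivative (\<lambda>h. cvec h i)) (at z)" for i
    by (rule bounded_linear_imp_has_derivative[OF bounded_linear_cvec])
  have dE: "((\<lambda>z. Re (eval_poly (conj_poly p) (cvec z i))) has_derivative
      (\<lambda>h. Re (\<Sum>k\<in>UNIV. grad_poly (conj_poly p) (v i) $ k * cvec h i $ k))) (at z)" for i
    unfolding v_def
    by (rule has_derivative_Re has_derivative_compose[OF dv has_derivative_eval_poly])+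
  have dH: "((\<lambda>z. Re (herm (cvec z i) (cvec z j) ^ d)) has_derivative
      (\<lambda>h. Re (of_nat d * (herm (cvec h i) (v j) + herm (v i) (cvec h j))
        * herm (v i) (v j) ^ (d - 1)))) (at z)" for i j
    unfolding v_def
    by (intro has_derivative_Re has_derivative_power has_derivative_herm dv)
  define R where "R i j = Re (herm (v i) (v j) ^ d)" for i j
  define E where "E i = Re (eval_poly (conj_poly p) (v i))" for i
  define g where "g h i = (\<Sum>k\<in>UNIV. grad_poly (conj_poly p) (v i) $ k * cvec h i $ k)" for h i
  define T where "T h i j = Re (of_nat d * herm (v i) (v j) ^ (d - 1) * herm (v i) (cvec h j))"
    for h i j
  have D: "(f_R d p has_derivative (\<lambda>h.
      1/2 * (\<Sum>i\<in>UNIV. \<Sum>j\<in>UNIV. w i * w j * Re (of_nat d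
          * (herm (cvec h i) (v j) + herm (v i) (cvec h j)) * herm (v i) (v j) ^ (d - 1))
        + (w i * fst h $ j + fst h $ i * w j) * R i j)
      - (\<Sum>i\<in>UNIV. w i * Re (g h i) + fst h $ i * E i) + 0)) (at z)"
    unfolding f R_def E_def g_def w_def v_def
    by (intro has_derivative_add has_derivative_diff has_derivative_sum has_derivative_mult
        has_derivative_mult_right has_derivative_const dw dE[unfolded v_def] dH[unfolded v_def])
  have R_sym: "R i j = R j i" for i j
    unfolding R_def by (subst cnj_herm[symmetric]) (simp flip: complex_cnj_power)
  have T_swap: "Re (of_nat d * (herm (cvec h i) (v j) + herm (v i) (cvec h j))
      * herm (v i) (v j) ^ (d - 1)) = T h j i + T h i j" for h i j
  proof -
    have "of_nat d * herm (cvec h i) (v j) * herm (v i) (v j) ^ (d - 1)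
        = cnj (of_nat d * herm (v j) (v i) ^ (d - 1) * herm (v j) (cvec h i))"
      by (simp add: cnj_herm mult_ac)
    then have "Re (of_nat d * herm (cvec h i) (v j) * herm (v i) (v j) ^ (d - 1)) = T h j i"
      unfolding T_def by (simp only: cnj.sel)
    then show ?thesis
      unfolding T_def by (simp add: algebra_simps)
  qed
  have sumT: "(\<Sum>i\<in>UNIV. \<Sum>j\<in>UNIV. w i * w j * T h j i) = (\<Sum>i\<in>UNIV. \<Sum>j\<in>UNIV. w i * w j * T h i j)" for h
    by (subst sum.swap) (simp add: mult_ac)
  have sumR: "(\<Sum>i\<in>UNIV. \<Sum>j\<in>UNIV. fst h $ i * w j * R i j)
      = (\<Sum>i\<in>UNIV. \<Sum>j\<in>UNIV. w i * fst h $ j * R i j)" for h :: "('n, 'r) rpoint"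
    by (subst sum.swap) (simp add: mult_ac R_sym)
  have eq: "1/2 * (\<Sum>i\<in>UNIV. \<Sum>j\<in>UNIV. w i * w j * (T h j i + T h i j)
        + (w i * fst h $ j + fst h $ i * w j) * R i j)
      - (\<Sum>i\<in>UNIV. w i * Re (g h i) + fst h $ i * E i) + 0
    = (\<Sum>j\<in>UNIV. fst h $ j * ((\<Sum>i\<in>UNIV. w i * R j i) - E j))
      + (\<Sum>j\<in>UNIV. (\<Sum>i\<in>UNIV. w i * w j * T h i j) - w j * Re (g h j))" for h
  proof -
    have "1/2 * (\<Sum>i\<in>UNIV. \<Sum>j\<in>UNIV. w i * w j * (T h j i + T h i j)
        + (w i * fst h $ j + fst h $ i * w j) * R i j)
      = (\<Sum>i\<in>UNIV. \<Sum>j\<in>UNIV. w i * w j * T h i j) + (\<Sum>i\<in>UNIV. \<Sum>j\<in>UNIV. fst h $ i * w j * R i j)"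
      by (simp add: distrib_left distrib_right sum.distrib sumT sumR)
    moreover have "(\<Sum>i\<in>UNIV. \<Sum>j\<in>UNIV. w i * w j * T h i j)
        = (\<Sum>j\<in>UNIV. \<Sum>i\<in>UNIV. w i * w j * T h i j)"
      by (rule sum.swap)
    ultimately show ?thesis
      by (simp add: right_diff_distrib sum_subtractf sum.distrib sum_distrib_left mult.assoc)
  qed
  have Re_eq: "Re (of_nat d * (\<Sum>i\<in>UNIV. of_real (w i) * of_real (w j)
           * herm (v i) (v j) ^ (d - 1) * herm (v i) (cvec h j)) - of_real (w j) * g h j)
      = (\<Sum>i\<in>UNIV. w i * w j * T h i j) - w j * Re (g h j)" for h j
  proof -
    have "of_nat d * (\<Sum>i\<in>UNIV. of_real (w i) * of_real (w j)
           * herm (v i) (v j) ^ (d - 1) * herm (v i) (cvec h j))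
        = (\<Sum>i\<in>UNIV. of_real (w i * w j) * (of_nat d * herm (v i) (v j) ^ (d - 1) * herm (v i) (cvec h j)))"
      by (simp add: sum_distrib_left mult_ac)
    then show ?thesis
      by (simp only: minus_complex.simps Re_sum Re_of_real_mult T_def)
  qed
  show ?thesis
    using D unfolding T_swap eq
    unfolding Re_eq[unfolded g_def] R_def E_def g_def .
qed

theorem proposition4p5:
  fixes p :: "'n::finite cpoly"
    and W :: "real ^ 'r::finite"
    and V :: "complex ^ 'r ^ 'n"
    and d :: nat
  assumes "d > 2"
    and "CARD('r) < generic_rank d CARD('n)"
    and "p \<in> homogeneous d"
  shows "GDERIV (f_R d p) (real_coords W V) :>
           (G1 d p W V,
            (\<chi> j k. Re (G2 d p W V $ j $ k)),
            (\<chi> j k. - Im (G2 d p W V $ j $ k)))"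
proof -
  let ?G = "(G1 d p W V, (\<chi> j k. Re (G2 d p W V $ j $ k)), (\<chi> j k. - Im (G2 d p W V $ j $ k)))"
  have v: "cvec (real_coords W V) = (\<lambda>j. column j V)"
    by (simp add: cvec_def real_coords_def fun_eq_iff vec_eq_iff)
  have w: "fst (real_coords W V) = W"
    by (simp add: real_coords_def)
  \<comment> \<open>The conjugated vectors in \<open>G2\<close>, paired bilinearly with a direction, give Hermitian products.\<close>
  have G2: "(\<Sum>k\<in>UNIV. G2 d p W V $ j $ k * cvec h j $ k)
      = of_nat d * (\<Sum>i\<in>UNIV. of_real (W $ i) * of_real (W $ j)
           * herm (column i V) (column j V) ^ (d - 1) * herm (column i V) (cvec h j))
         - of_real (W $ j) * (\<Sum>k\<in>UNIV. grad_poly (conj_poly p) (column j V) $ k * cvec h j $ k)"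
    for h j
  proof -
    have "G2 d p W V $ j $ k = of_nat d * (\<Sum>i\<in>UNIV. of_real (W $ i) * of_real (W $ j)
           * herm (column i V) (column j V) ^ (d - 1) * cnj (column i V $ k))
         - of_real (W $ j) * grad_poly (conj_poly p) (column j V) $ k" for k
      by (simp add: G2_def conj_vec_def)
    then have "(\<Sum>k\<in>UNIV. G2 d p W V $ j $ k * cvec h j $ k)
      = (\<Sum>k\<in>UNIV. \<Sum>i\<in>UNIV. of_nat d * (of_real (W $ i) * of_real (W $ j)
           * herm (column i V) (column j V) ^ (d - 1) * (cnj (column i V $ k) * cvec h j $ k)))
         - of_real (W $ j) * (\<Sum>k\<in>UNIV. grad_poly (conj_poly p) (column j V) $ k * cvec h j $ k)"
      by (simp add: right_diff_distrib sum_subtractf sum_distrib_left sum_distrib_right mult_ac)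
    then show ?thesis
      unfolding herm_def[of _ "cvec h j"] sum_distrib_left
      by (subst (asm) sum.swap)
  qed
  \<comment> \<open>\<open>Re (a c) = Re a Re c - Im a Im c\<close> explains the minus sign in the last block.\<close>
  have inner_G: "h \<bullet> ?G = (\<Sum>j\<in>UNIV. fst h $ j * G1 d p W V $ j)
      + (\<Sum>j\<in>UNIV. Re (\<Sum>k\<in>UNIV. G2 d p W V $ j $ k * cvec h j $ k))" for h
    by (simp add: inner_prod_def inner_vec_def cvec_def sum.distrib[symmetric] mult_ac)
  show ?thesis
    unfolding gderiv_def inner_G unfolding G2 G1_def vec_lambda_beta
    using has_derivative_f_R[OF assms(3), of "real_coords W V"] unfolding v w .
qed

end
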